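(* For every $n$ and every search sequence $X = x_1,\ldots,x_m$ over $\{1,\ldots,n\}$, $$\min_T R_r(T,X) = \Omega\Big(\min_T R_\ell(T,X)\Big) = \Omega(OPT(X)),$$ where the minima range over all static BSTs $T$ on $\{1,\ldots,n\}$. Furthermore, there exist classes of search sequences of any length $m$, denoted $X^1_m$ and $X^2_m$, such that $$\min_T R_r(T,X^1_m) = \omega\Big(\min_T R_\ell(T,X^1_m)\Big) \quad\text{and}\quad \min_T R_\ell(T,X^2_m) = \omega(OPT(X^2_m)).$$
   Context: A static BST $T$ stores keys $1,\ldots,n$ and is never modified. $d_T(v)$ is the depth of $v$ (root has depth $0$), $\mathrm{LCA}_T(i,j)$ the lowest common ancestor, and $r(T,i,j) = d_T(i)+d_T(j)-2d_T(\mathrm{LCA}_T(i,j))$. For a search sequence $X = x_1,\ldots,x_m$: the root finger cost is $R_r(T,X) = \sum_{i=1}^m d_T(x_i)$ (each search starts at the root), and the lazy finger cost is $R_\ell(T,X) = \sum_{i=1}^m r(T,x_{i-1},x_i)$ with $x_0$ the root of $T$ (each search starts where the previous one ended). $OPT(X)$ denotes the minimum cost with which any binary search tree allowing rotations (the standard dynamic BST model: a single pointer starting at the root for each search, unit cost per pointer move and per rotation) can execute $X$. The asymptotic notations are with respect to $n$ (and $m$) growing. *)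

theory Defs
  imports Complex_Main "HOL-Library.Tree" "HOL-Library.Landau_Symbols"
begin

section \<open>Static binary search trees\<close>

definition bsts :: "nat \<Rightarrow> nat tree set" where
  "bsts n = {T. bst T \<and> set_tree T = {1..n}}"

text \<open>Number of edges from the root to \<open>x\<close>, following the search path; only meaningful
  for a key \<open>x\<close> of a search tree.\<close>
fun depth :: "'a::linorder tree \<Rightarrow> 'a \<Rightarrow> nat" where
  "depth \<langle>\<rangle> x = 0"
| "depth \<langle>l, a, r\<rangle> x =
     (if x = a then 0 else if x < a then Suc (depth l x) else Suc (depth r x))"

text \<open>Every node is an ancestor of itself.\<close>
definition ancestor :: "'a tree \<Rightarrow> 'a \<Rightarrow> 'a \<Rightarrow> bool" where
  "ancestor T u v \<longleftrightarrow> (\<exists>l r. \<langle>l, u, r\<rangle> \<in> subtrees T \<and> v \<in> set_tree \<langle>l, u, r\<rangle>)"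

definition lca :: "'a::linorder tree \<Rightarrow> 'a \<Rightarrow> 'a \<Rightarrow> 'a" where
  "lca T i j = (ARG_MAX (depth T) u. ancestor T u i \<and> ancestor T u j)"

text \<open>The subtraction does not truncate for keys \<open>i\<close>, \<open>j\<close> of a search tree, since an
  ancestor of a node is never deeper than that node.\<close>
definition tree_dist :: "'a::linorder tree \<Rightarrow> 'a \<Rightarrow> 'a \<Rightarrow> nat" where
  "tree_dist T i j = depth T i + depth T j - 2 * depth T (lca T i j)"

definition root_cost :: "'a::linorder tree \<Rightarrow> 'a list \<Rightarrow> nat" where
  "root_cost T X = (\<Sum>i<length X. depth T (X ! i))"

text \<open>In the list \<open>value T # X\<close> the entry at position \<open>i\<close> is $x_i$, with $x_0$ the root,
  while \<open>X ! i\<close> is $x_{i+1}$.\<close>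
definition lazy_cost :: "'a::linorder tree \<Rightarrow> 'a list \<Rightarrow> nat" where
  "lazy_cost T X = (\<Sum>i<length X. tree_dist T ((value T # X) ! i) (X ! i))"

text \<open>Costs are natural numbers, so the infimum of a nonempty set of costs is its minimum.\<close>
definition min_root_cost :: "nat \<Rightarrow> nat list \<Rightarrow> nat" where
  "min_root_cost n X = (INF T\<in>bsts n. root_cost T X)"

definition min_lazy_cost :: "nat \<Rightarrow> nat list \<Rightarrow> nat" where
  "min_lazy_cost n X = (INF T\<in>bsts n. lazy_cost T X)"


section \<open>Binary search trees with rotations\<close>

definition child :: "'a tree \<Rightarrow> 'a \<Rightarrow> 'a \<Rightarrow> bool" where
  "child T a b \<longleftrightarrow>
     (\<exists>l r s t. \<langle>l, a, r\<rangle> \<in> subtrees T \<and> (l = \<langle>s, b, t\<rangle> \<or> r = \<langle>s, b, t\<rangle>))"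

text \<open>\<open>rotate_up b T T'\<close>: the tree \<open>T'\<close> results from \<open>T\<close> by rotating \<open>b\<close> with its parent.\<close>
inductive rotate_up :: "'a \<Rightarrow> 'a tree \<Rightarrow> 'a tree \<Rightarrow> bool" for b where
  "rotate_up b \<langle>\<langle>A, b, B\<rangle>, a, C\<rangle> \<langle>A, b, \<langle>B, a, C\<rangle>\<rangle>"
| "rotate_up b \<langle>A, a, \<langle>B, b, C\<rangle>\<rangle> \<langle>\<langle>A, a, B\<rangle>, b, C\<rangle>"
| "rotate_up b l l' \<Longrightarrow> rotate_up b \<langle>l, a, r\<rangle> \<langle>l', a, r\<rangle>"
| "rotate_up b r r' \<Longrightarrow> rotate_up b \<langle>l, a, r\<rangle> \<langle>l, a, r'\<rangle>"

text \<open>Unit-cost operations. A state consists of the current tree and the key of the node at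
  which the pointer is; keys are pairwise distinct, so the key determines the node.\<close>
inductive step :: "'a tree \<times> 'a \<Rightarrow> 'a tree \<times> 'a \<Rightarrow> bool" where
  move_down: "child T a b \<Longrightarrow> step (T, a) (T, b)"
| move_up: "child T a b \<Longrightarrow> step (T, b) (T, a)"
| rotation: "rotate_up b T T' \<Longrightarrow> step (T, b) (T', b)"

text \<open>A search for \<open>x\<close> starts with the pointer at the root and has to bring it to \<open>x\<close> at
  some point; the tree may be restructured before and after that.\<close>
definition search :: "'a tree \<Rightarrow> 'a \<Rightarrow> 'a tree \<Rightarrow> nat \<Rightarrow> bool" where
  "search T x T' c \<longleftrightarrow>
     (\<exists>i j U v. (step ^^ i) (T, value T) (U, x) \<and> (step ^^ j) (U, x) (T', v) \<and> c = i + j)"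

inductive executes :: "'a tree \<Rightarrow> 'a list \<Rightarrow> nat \<Rightarrow> bool" where
  "executes T [] 0"
| "search T x T' c \<Longrightarrow> executes T' X d \<Longrightarrow> executes T (x # X) (c + d)"

text \<open>The initial tree is part of the optimisation, as it is in the static minima.\<close>
definition OPT :: "nat \<Rightarrow> nat list \<Rightarrow> nat" where
  "OPT n X = Inf {c. \<exists>T\<in>bsts n. executes T X c}"


section \<open>The minima are attained\<close>

lemma bsts_nonempty: "bsts n \<noteq> {}"
proof (induction n)
  case 0
  have "\<langle>\<rangle> \<in> bsts 0" by (simp add: bsts_def)
  then show ?case by blast
next
  case (Suc n)
  then obtain T where "T \<in> bsts n" by blast
  then have "\<langle>T, Suc n, \<langle>\<rangle>\<rangle> \<in> bsts (Suc n)" by (auto simp: bsts_def)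
  then show ?case by blast
qed

lemma subtree_reach:
  assumes "x \<in> set_tree S" and "S \<in> subtrees T"
  shows "\<exists>i. (step ^^ i) (T, value S) (T, x)"
  using assms
proof (induction S)
  case (Node l a r)
  have sub: "subtrees S \<subseteq> subtrees U" if "S \<in> subtrees U" for S U :: "'a tree"
    using that by (induction U) auto
  have refl: "S \<in> subtrees S" for S :: "'a tree" by (cases S) auto
  have lr: "l \<in> subtrees T" "r \<in> subtrees T"
    using sub[OF Node.prems(2)] refl[of l] refl[of r] by auto
  have *: ?case if x: "x \<in> set_tree s" and s: "s = l \<or> s = r"
    and IH: "\<exists>i. (step ^^ i) (T, value s) (T, x)" for s
  proof -
    obtain u b v where [simp]: "s = \<langle>u, b, v\<rangle>" using x by (cases s) auto
    have "child T a b" using Node.prems(2) s unfolding child_def by auto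
    then have "step (T, a) (T, b)" by (rule step.move_down)
    moreover obtain i where "(step ^^ i) (T, b) (T, x)" using IH by auto
    ultimately have "(step ^^ Suc i) (T, a) (T, x)" by (rule relpowp_Suc_I2)
    then show ?thesis unfolding tree.sel by blast
  qed
  show ?case
  proof (cases "x = a")
    case True
    then have "(step ^^ 0) (T, value \<langle>l, a, r\<rangle>) (T, x)" by simp
    then show ?thesis by blast
  next
    case False
    then show ?thesis using Node lr * by auto
  qed
qed simp

lemma executes_exists:
  assumes "set X \<subseteq> set_tree T"
  shows "\<exists>c. executes T X c"
  using assms
proof (induction X)
  case Nil
  show ?case by (blast intro: executes.intros)
next
  case (Cons x X)
  have "T \<in> subtrees T" by (cases T) auto
  with Cons.prems obtain i where "(step ^^ i) (T, value T) (T, x)"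
    using subtree_reach[of x T T] by auto
  moreover have "(step ^^ 0) (T, x) (T, x)" by simp
  ultimately have "search T x T (i + 0)" unfolding search_def by blast
  then show ?case using Cons by (force intro: executes.intros)
qed

lemma OPT_attained:
  assumes "set X \<subseteq> {1..n}"
  shows "\<exists>T\<in>bsts n. executes T X (OPT n X)"
proof -
  obtain T where T: "T \<in> bsts n" using bsts_nonempty by blast
  then have "set X \<subseteq> set_tree T" using assms by (simp add: bsts_def)
  from executes_exists[OF this] T have "{c. \<exists>T\<in>bsts n. executes T X c} \<noteq> {}" by blast
  from Inf_nat_def1[OF this] show ?thesis unfolding OPT_def by simp
qed

lemma min_root_cost_attained: "\<exists>T\<in>bsts n. min_root_cost n X = root_cost T X"
  using Inf_nat_def1[of "(\<lambda>T. root_cost T X) ` bsts n"] bsts_nonempty[of n]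
  unfolding min_root_cost_def by auto

lemma min_lazy_cost_attained: "\<exists>T\<in>bsts n. min_lazy_cost n X = lazy_cost T X"
  using Inf_nat_def1[of "(\<lambda>T. lazy_cost T X) ` bsts n"] bsts_nonempty[of n]
  unfolding min_lazy_cost_def by auto

end

theory Submission
  imports Defs
begin

text \<open>The lazy finger never pays more than twice the depths of its targets. A tree with rotations
  simulates it by keeping the static tree hung up at the finger: moving the finger along one edge
  amounts to at most two rotations near the root.

  Both separations use that at most $2^d$ keys of a search tree have depth less than \<open>d\<close>, so a
  sequence that visits many keys equally often meets large depths on average. Sweeping back and forth
  over the keys is cheap for the lazy finger, which walks along a path, but each root search pays the
  depth. Inserting the extreme keys \<open>1\<close> and \<open>n\<close> between the keys of the sweep forces the lazy finger
  through the root of its tree, whereas rotations keep \<open>1\<close>, \<open>n\<close> and the current key of the sweep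
  near the root at constant cost.\<close>

section \<open>Distances in a search tree\<close>

text \<open>Depth of the lowest common ancestor, computed along the search paths: they run together
  until a key separates \<open>i\<close> and \<open>j\<close> or equals one of them. This form suits
  induction on the tree, unlike \<open>ARG_MAX\<close>.\<close>

fun common_depth :: "'a::linorder tree \<Rightarrow> 'a \<Rightarrow> 'a \<Rightarrow> nat" where
  "common_depth \<langle>\<rangle> i j = 0"
| "common_depth \<langle>l, a, r\<rangle> i j =
     (if i < a \<and> j < a then Suc (common_depth l i j)
      else if a < i \<and> a < j then Suc (common_depth r i j) else 0)"

lemma ancestor_Leaf [simp]: "\<not> ancestor \<langle>\<rangle> u v"
  by (simp add: ancestor_def)

lemma ancestor_Node [simp]:
  "ancestor \<langle>l, a, r\<rangle> u v \<longleftrightarrow>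
     u = a \<and> v \<in> set_tree \<langle>l, a, r\<rangle> \<or> ancestor l u v \<or> ancestor r u v"
  unfolding ancestor_def by auto

lemma ancestor_in_set:
  "ancestor T u v \<Longrightarrow> u \<in> set_tree T \<and> v \<in> set_tree T"
  by (induction T) auto

text \<open>The witness is the node where the two search paths part.\<close>

lemma common_depth_attained:
  assumes "bst T" "i \<in> set_tree T" "j \<in> set_tree T"
  shows "\<exists>u. ancestor T u i \<and> ancestor T u j \<and> depth T u = common_depth T i j"
  using assms
proof (induction T)
  case (Node l a r)
  consider "i < a \<and> j < a" | "a < i \<and> a < j" | "\<not> (i < a \<and> j < a)" "\<not> (a < i \<and> a < j)"
    by blast
  then show ?case
  proof cases
    case 1
    then have "i \<in> set_tree l" "j \<in> set_tree l" using Node.prems by auto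
    with Node.IH(1) Node.prems obtain u
      where u: "ancestor l u i" "ancestor l u j" "depth l u = common_depth l i j" by auto
    then have "u < a" using ancestor_in_set[OF u(1)] Node.prems by auto
    with u 1 show ?thesis by (intro exI[of _ u]) auto
  next
    case 2
    then have "i \<in> set_tree r" "j \<in> set_tree r" using Node.prems by auto
    with Node.IH(2) Node.prems obtain u
      where u: "ancestor r u i" "ancestor r u j" "depth r u = common_depth r i j" by auto
    then have "a < u" using ancestor_in_set[OF u(1)] Node.prems by auto
    with u 2 show ?thesis by (intro exI[of _ u]) auto
  next
    case 3
    then show ?thesis using Node.prems by (intro exI[of _ a]) auto
  qed
qed simp

lemma common_depth_greatest:
  assumes "bst T" "ancestor T u i" "ancestor T u j"
  shows "depth T u \<le> common_depth T i j"
  using assms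
proof (induction T)
  case (Node l a r)
  consider "u = a" | "ancestor l u i" "ancestor l u j" | "ancestor r u i" "ancestor r u j"
    | "ancestor l u i" "ancestor r u j" | "ancestor r u i" "ancestor l u j"
    using Node.prems(2,3) by auto
  then show ?case
  proof cases
    case 2
    then have "depth l u \<le> common_depth l i j" "u < a" "i < a" "j < a"
      using Node.IH(1) Node.prems(1) ancestor_in_set by fastforce+
    then show ?thesis by simp
  next
    case 3
    then have "depth r u \<le> common_depth r i j" "a < u" "a < i" "a < j"
      using Node.IH(2) Node.prems(1) ancestor_in_set by fastforce+
    then show ?thesis by auto
  \<comment> \<open>In the two mixed cases \<open>u\<close> would lie in both subtrees, hence on
    both sides of \<open>a\<close>.\<close>
  next
    case 4
    then show ?thesis using Node.prems(1) ancestor_in_set by fastforce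
  next
    case 5
    then show ?thesis using Node.prems(1) ancestor_in_set by fastforce
  qed simp
qed simp

text \<open>Only the depth of \<open>lca\<close> enters, and it is fixed by any common ancestor
  attaining the upper bound \<open>common_depth\<close>.\<close>

lemma tree_dist_eq:
  assumes "bst T" "i \<in> set_tree T" "j \<in> set_tree T"
  shows "tree_dist T i j = depth T i + depth T j - 2 * common_depth T i j"
proof -
  obtain u where u: "ancestor T u i \<and> ancestor T u j" "depth T u = common_depth T i j"
    using common_depth_attained[OF assms] by blast
  have "depth T (lca T i j) = depth T u"
    unfolding lca_def
    by (rule arg_max_equality) (use u common_depth_greatest[OF assms(1)] in auto)
  then show ?thesis by (simp add: tree_dist_def u)
qed

lemma common_depth_commute: "common_depth T i j = common_depth T j i"
  by (induction T) auto

lemma tree_dist_commute: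
  assumes "bst T" "i \<in> set_tree T" "j \<in> set_tree T"
  shows "tree_dist T i j = tree_dist T j i"
  using assms by (simp add: tree_dist_eq common_depth_commute[of T i j])

lemma tree_dist_self: "bst T \<Longrightarrow> i \<in> set_tree T \<Longrightarrow> tree_dist T i i = 0"
proof -
  assume *: "bst T" "i \<in> set_tree T"
  then have "common_depth T i i = depth T i" by (induction T) auto
  with * show ?thesis by (simp add: tree_dist_eq)
qed

text \<open>Both depths and the common depth grow by one below the new root, which cancels.\<close>

lemma tree_dist_left:
  assumes "bst \<langle>l, a, r\<rangle>" "i \<in> set_tree l" "j \<in> set_tree l"
  shows "tree_dist \<langle>l, a, r\<rangle> i j = tree_dist l i j"
  using assms by (auto simp: tree_dist_eq)

lemma tree_dist_right:
  assumes "bst \<langle>l, a, r\<rangle>" "i \<in> set_tree r" "j \<in> set_tree r"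
  shows "tree_dist \<langle>l, a, r\<rangle> i j = tree_dist r i j"
  using assms by (auto simp: tree_dist_eq)

text \<open>The root separates the two keys, so the common depth is 0 and the walk passes through
  the root.\<close>

lemma tree_dist_across:
  assumes "bst \<langle>l, a, r\<rangle>" "i \<in> set_tree \<langle>l, a, r\<rangle>" "j \<in> set_tree \<langle>l, a, r\<rangle>" "i \<le> a" "a \<le> j"
  shows "tree_dist \<langle>l, a, r\<rangle> i j = depth \<langle>l, a, r\<rangle> i + depth \<langle>l, a, r\<rangle> j"
  using assms by (subst tree_dist_eq) auto

lemma depth_value [simp]: "depth T (value T) = 0"
  by (cases T) auto

text \<open>A walk is no longer than the detour through the root, and each searched key is an
  endpoint of at most two walks.\<close>

lemma lazy_cost_le_root_cost: "lazy_cost T X \<le> 2 * root_cost T X"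
proof -
  \<comment> \<open>The start \<open>v\<close> is left free for the induction; its depth vanishes
    once \<open>v\<close> is the root.\<close>
  have "(\<Sum>i<length X. tree_dist T ((v # X) ! i) (X ! i)) \<le> depth T v + 2 * root_cost T X" for v
  proof (induction X arbitrary: v)
    case (Cons x X)
    have "tree_dist T v x \<le> depth T v + depth T x" by (simp add: tree_dist_def)
    moreover have "root_cost T (x # X) = depth T x + root_cost T X"
      by (simp add: root_cost_def sum.lessThan_Suc_shift del: sum.lessThan_Suc)
    ultimately show ?case using Cons.IH[of x]
      by (simp add: sum.lessThan_Suc_shift del: sum.lessThan_Suc)
  qed (simp add: root_cost_def)
  from this[of "value T"] show ?thesis by (simp add: lazy_cost_def)
qed

lemma min_lazy_cost_le_min_root_cost: "min_lazy_cost n X \<le> 2 * min_root_cost n X"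
proof -
  obtain T where T: "T \<in> bsts n" "min_root_cost n X = root_cost T X"
    using min_root_cost_attained by blast
  have "min_lazy_cost n X \<le> lazy_cost T X"
    unfolding min_lazy_cost_def by (rule cINF_lower) (use T in auto)
  then show ?thesis using lazy_cost_le_root_cost[of T X] T by simp
qed

section \<open>Simulating the lazy finger\<close>

definition reach :: "nat \<Rightarrow> 'a tree \<times> 'a \<Rightarrow> 'a tree \<times> 'a \<Rightarrow> bool" where
  "reach c s t \<longleftrightarrow> (\<exists>k\<le>c. (step ^^ k) s t)"

lemma reach_refl: "reach c s s"
  unfolding reach_def by (intro exI[of _ 0]) auto

lemma reach_trans: "reach c s t \<Longrightarrow> reach d t u \<Longrightarrow> reach (c + d) s u"
  unfolding reach_def by (meson add_mono relpowp_trans)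

lemma reach_mono: "reach c s t \<Longrightarrow> c \<le> d \<Longrightarrow> reach d s t"
  unfolding reach_def by (meson le_trans)

lemma reach_step: "step s t \<Longrightarrow> reach c t u \<Longrightarrow> reach (Suc c) s u"
  unfolding reach_def by (meson Suc_le_mono relpowp_Suc_I2)

section \<open>Undoing moves and rotations at constant cost\<close>

lemma child_Node [simp]:
  "child \<langle>l, c, r\<rangle> a b \<longleftrightarrow>
     c = a \<and> ((\<exists>s t. l = \<langle>s, b, t\<rangle>) \<or> (\<exists>s t. r = \<langle>s, b, t\<rangle>)) \<or> child l a b \<or> child r a b"
  by (simp add: child_def) blast

text \<open>Rotating the former parent \<open>a\<close> back up restores the tree. The two
  \<open>child\<close> facts let the pointer go from \<open>b\<close> to \<open>a\<close> before
  this rotation and return to \<open>b\<close> after it.\<close>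

lemma rotate_up_reverse:
  "rotate_up b T T' \<Longrightarrow> \<exists>a. child T' b a \<and> rotate_up a T' T \<and> child T a b"
proof (induction rule: rotate_up.induct)
  case (1 A B a C)
  show ?case by (intro exI[of _ a] conjI rotate_up.intros(2)) simp_all
next
  case (2 A a B C)
  show ?case by (intro exI[of _ a] conjI rotate_up.intros(1)) simp_all
next
  case (3 l l' a r)
  then show ?case by (auto intro: rotate_up.intros(3))
next
  case (4 r r' l a)
  then show ?case by (auto intro: rotate_up.intros(4))
qed

text \<open>A move is undone by the opposite move. Undoing a rotation takes a move, a rotation and a
  move.\<close>

lemma step_reverse: "step s t \<Longrightarrow> reach 3 t s"
proof (induction rule: step.induct)
  case (move_down T a b)
  from reach_step[OF step.move_up[OF this] reach_refl[of 0]] show ?case by (rule reach_mono) simp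
next
  case (move_up T a b)
  from reach_step[OF step.move_down[OF this] reach_refl[of 0]] show ?case by (rule reach_mono) simp
next
  case (rotation b T T')
  obtain a where a: "child T' b a" "rotate_up a T' T" "child T a b"
    using rotate_up_reverse[OF rotation] by blast
  have "reach (Suc (Suc (Suc 0))) (T', b) (T, b)"
    by (rule reach_step[OF step.move_down[OF a(1)] reach_step[OF step.rotation[OF a(2)]
        reach_step[OF step.move_down[OF a(3)] reach_refl]]])
  then show ?case by (simp add: numeral_3_eq_3)
qed

lemma reach_reverse:
  assumes "reach c s t"
  shows "reach (3 * c) t s"
proof -
  have "reach (3 * k) t s" if "(step ^^ k) s t" for k
    using that
  proof (induction k arbitrary: t)
    case 0
    then show ?case by (simp add: reach_refl)
  next
    case (Suc k)
    then obtain u where u: "(step ^^ k) s u" "step u t" by auto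
    show ?case using reach_trans[OF step_reverse[OF u(2)] Suc.IH[OF u(1)]] by simp
  qed
  with assms show ?thesis unfolding reach_def[of c] by (meson mult_le_mono2 reach_mono)
qed

text \<open>\<open>reroot ls rs T x\<close> hangs the tree up at the node \<open>x\<close> of \<open>T\<close>. The lists hold the ancestors
  of \<open>T\<close> smaller (larger) than its keys, nearest first, each with its subtree away from \<open>T\<close>.
  The smaller ancestors, nearest on top, form a left path below \<open>x\<close>: each subtree moves from its
  ancestor to the next one down this path, where the right child has become free.\<close>

fun left_spine :: "('a tree \<times> 'a) list \<Rightarrow> 'a tree \<Rightarrow> 'a tree" where
  "left_spine [] t = t"
| "left_spine ((L, a) # ls) t = \<langle>left_spine ls L, a, t\<rangle>"

fun right_spine :: "('a tree \<times> 'a) list \<Rightarrow> 'a tree \<Rightarrow> 'a tree" where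
  "right_spine [] t = t"
| "right_spine ((R, a) # rs) t = \<langle>t, a, right_spine rs R\<rangle>"

fun reroot :: "('a tree \<times> 'a) list \<Rightarrow> ('a tree \<times> 'a) list \<Rightarrow> 'a::linorder tree \<Rightarrow> 'a \<Rightarrow> 'a tree"
where
  "reroot ls rs \<langle>\<rangle> x = \<langle>\<rangle>"
| "reroot ls rs \<langle>l, a, r\<rangle> x =
     (if x = a then \<langle>left_spine ls l, a, right_spine rs r\<rangle>
      else if x < a then reroot ls ((r, a) # rs) l x
      else reroot ((l, a) # ls) rs r x)"

text \<open>The finger passes from \<open>a\<close> to its left child \<open>c\<close>. If there is
  a smaller ancestor, the nearest one, \<open>b\<close>, stands between them as left child of
  \<open>a\<close>, with \<open>c\<close> as its right child. Rotating \<open>c\<close> over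
  \<open>b\<close> and then over \<open>a\<close> leaves \<open>l\<close> below \<open>b\<close> and
  \<open>r\<close> below \<open>a\<close>; without \<open>b\<close> the second rotation
  suffices.\<close>

lemma reroot_down_left:
  "reach 4 (\<langle>left_spine ls \<langle>l, c, r\<rangle>, a, R\<rangle>, a) (\<langle>left_spine ls l, c, \<langle>r, a, R\<rangle>\<rangle>, c)"
proof (cases ls)
  case Nil
  have "reach (Suc (Suc 2)) (\<langle>\<langle>l, c, r\<rangle>, a, R\<rangle>, a) (\<langle>l, c, \<langle>r, a, R\<rangle>\<rangle>, c)"
    apply (rule reach_step[OF step.move_down[of _ _ c]], simp)
    apply (rule reach_step[OF step.rotation[OF rotate_up.intros(1)]])
    apply (rule reach_refl)
    done
  with Nil show ?thesis by simp
next
  case (Cons p ls')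
  obtain L b where p: "p = (L, b)" by (cases p)
  define M where "M = left_spine ls' L"
  have "reach (Suc (Suc (Suc (Suc 0)))) (\<langle>\<langle>M, b, \<langle>l, c, r\<rangle>\<rangle>, a, R\<rangle>, a)
      (\<langle>\<langle>M, b, l\<rangle>, c, \<langle>r, a, R\<rangle>\<rangle>, c)"
    apply (rule reach_step[OF step.move_down[of _ _ b]], simp)
    apply (rule reach_step[OF step.move_down[of _ _ c]], simp)
    apply (rule reach_step[OF step.rotation[OF rotate_up.intros(3)[OF rotate_up.intros(2)]]])
    apply (rule reach_step[OF step.rotation[OF rotate_up.intros(1)]])
    apply (rule reach_refl)
    done
  with Cons p M_def show ?thesis by (simp add: eval_nat_numeral)
qed

text \<open>Mirror image of \<open>reroot_down_left\<close>.\<close>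

lemma reroot_down_right:
  "reach 4 (\<langle>L, a, right_spine rs \<langle>l, c, r\<rangle>\<rangle>, a) (\<langle>\<langle>L, a, l\<rangle>, c, right_spine rs r\<rangle>, c)"
proof (cases rs)
  case Nil
  have "reach (Suc (Suc 2)) (\<langle>L, a, \<langle>l, c, r\<rangle>\<rangle>, a) (\<langle>\<langle>L, a, l\<rangle>, c, r\<rangle>, c)"
    apply (rule reach_step[OF step.move_down[of _ _ c]], simp)
    apply (rule reach_step[OF step.rotation[OF rotate_up.intros(2)]])
    apply (rule reach_refl)
    done
  with Nil show ?thesis by simp
next
  case (Cons p rs')
  obtain R b where p: "p = (R, b)" by (cases p)
  define M where "M = right_spine rs' R"
  have "reach (Suc (Suc (Suc (Suc 0)))) (\<langle>L, a, \<langle>\<langle>l, c, r\<rangle>, b, M\<rangle>\<rangle>, a)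
      (\<langle>\<langle>L, a, l\<rangle>, c, \<langle>r, b, M\<rangle>\<rangle>, c)"
    apply (rule reach_step[OF step.move_down[of _ _ b]], simp)
    apply (rule reach_step[OF step.move_down[of _ _ c]], simp)
    apply (rule reach_step[OF step.rotation[OF rotate_up.intros(4)[OF rotate_up.intros(1)]]])
    apply (rule reach_step[OF step.rotation[OF rotate_up.intros(2)]])
    apply (rule reach_refl)
    done
  with Cons p M_def show ?thesis by (simp add: eval_nat_numeral)
qed

lemma reroot_value: "T \<noteq> \<langle>\<rangle> \<Longrightarrow>
  reroot ls rs T (value T) = \<langle>left_spine ls (left T), value T, right_spine rs (right T)\<rangle>"
  by (cases T) auto

text \<open>Every edge of the descent costs at most 4 and extends \<open>ls\<close> or
  \<open>rs\<close> by the node left behind, so both lists vary in the induction.\<close>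

lemma reroot_reach_down:
  assumes "bst T" "x \<in> set_tree T"
  shows "reach (4 * depth T x) (reroot ls rs T (value T), value T) (reroot ls rs T x, x)"
  using assms
proof (induction T arbitrary: ls rs)
  case (Node l a r)
  consider "x = a" | "x \<in> set_tree l" "x < a" | "x \<in> set_tree r" "a < x"
    using Node.prems by auto
  then show ?case
  proof cases
    case 1
    then show ?thesis by (simp add: reach_refl)
  next
    case 2
    then have l: "l = \<langle>left l, value l, right l\<rangle>" by (cases l) auto
    have "reach 4 (reroot ls rs \<langle>l, a, r\<rangle> a, a) (reroot ls ((r, a) # rs) l (value l), value l)"
      using reroot_down_left[of ls "left l" "value l" "right l" a "right_spine rs r"] l
      by (metis reroot.simps(2) reroot_value right_spine.simps(2) tree.distinct(1))
    from reach_trans[OF this Node.IH(1)] show ?thesis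
      using 2 Node.prems by (auto simp: add.commute)
  next
    case 3
    then have r: "r = \<langle>left r, value r, right r\<rangle>" by (cases r) auto
    have "reach 4 (reroot ls rs \<langle>l, a, r\<rangle> a, a) (reroot ((l, a) # ls) rs r (value r), value r)"
      using reroot_down_right[of "left_spine ls l" a rs "left r" "value r" "right r"] r
      by (metis reroot.simps(2) reroot_value left_spine.simps(2) tree.distinct(1))
    from reach_trans[OF this Node.IH(2)] show ?thesis
      using 3 Node.prems by (auto simp: add.commute)
  qed
qed simp

text \<open>While \<open>x\<close> and \<open>y\<close> lie on the same side of the root, the root
  merely joins \<open>ls\<close> or \<open>rs\<close>. Once it separates them, or is one of them,
  the descent to \<open>x\<close> is undone and the descent to \<open>y\<close> follows; undoing
  costs three times the 4 per edge, which gives 12.\<close>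

lemma reroot_reach:
  assumes "bst T" "x \<in> set_tree T" "y \<in> set_tree T"
  shows "reach (12 * tree_dist T x y) (reroot ls rs T x, x) (reroot ls rs T y, y)"
  using assms
proof (induction T arbitrary: ls rs)
  case (Node l a r)
  have via_root: ?case
    if "tree_dist \<langle>l, a, r\<rangle> x y = depth \<langle>l, a, r\<rangle> x + depth \<langle>l, a, r\<rangle> y"
  proof -
    have "reach (3 * (4 * depth \<langle>l, a, r\<rangle> x) + 4 * depth \<langle>l, a, r\<rangle> y)
        (reroot ls rs \<langle>l, a, r\<rangle> x, x) (reroot ls rs \<langle>l, a, r\<rangle> y, y)"
      by (rule reach_trans[OF reach_reverse[OF reroot_reach_down] reroot_reach_down])
        (use Node.prems in simp_all)
    moreover have "3 * (4 * p) + 4 * q \<le> 12 * (p + q)" for p q :: nat by simp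
    ultimately show ?thesis unfolding that by (rule reach_mono)
  qed
  consider "x < a" "y < a" | "a < x" "a < y" | "x \<le> a" "a \<le> y" | "y \<le> a" "a \<le> x"
    by fastforce
  then show ?case
  proof cases
    case 1
    then have "x \<in> set_tree l" "y \<in> set_tree l" using Node.prems by auto
    then show ?thesis
      using 1 Node.IH(1)[of ls "(r, a) # rs"] Node.prems(1) by (auto simp: tree_dist_left)
  next
    case 2
    then have "x \<in> set_tree r" "y \<in> set_tree r" using Node.prems by auto
    then show ?thesis
      using 2 Node.IH(2)[of "(l, a) # ls" rs] Node.prems(1) by (auto simp: tree_dist_right)
  next
    case 3
    show ?thesis by (rule via_root, rule tree_dist_across) (use 3 Node.prems in auto)
  next
    case 4
    have "tree_dist \<langle>l, a, r\<rangle> y x = depth \<langle>l, a, r\<rangle> y + depth \<langle>l, a, r\<rangle> x"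
      by (rule tree_dist_across) (use 4 Node.prems in auto)
    then show ?thesis
      using tree_dist_commute[OF Node.prems(1-3)] by (intro via_root) linarith
  qed
qed simp

text \<open>Each search restarts at the root, so the finger must be there between searches.\<close>

lemma value_reroot: "bst T \<Longrightarrow> x \<in> set_tree T \<Longrightarrow> value (reroot ls rs T x) = x"
  by (induction T arbitrary: ls rs) auto

lemma search_reach:
  assumes "reach c (T, value T) (U, x)" "reach d (U, x) (T', v)"
  shows "\<exists>e\<le>c + d. search T x T' e"
proof -
  from assms(1) obtain i where i: "i \<le> c" "(step ^^ i) (T, value T) (U, x)"
    unfolding reach_def by (elim exE conjE)
  from assms(2) obtain j where j: "j \<le> d" "(step ^^ j) (U, x) (T', v)"
    unfolding reach_def by (elim exE conjE)
  have "search T x T' (i + j)"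
    unfolding search_def by (rule exI conjI i(2) j(2) refl)+
  with i(1) j(1) show ?thesis by (meson add_mono)
qed

text \<open>Invariant of the simulation: after each search the current tree is \<open>T\<close> hung
  up at the key just found.\<close>

lemma executes_reroot:
  assumes "bst T" "v \<in> set_tree T" "set X \<subseteq> set_tree T"
  shows "\<exists>c \<le> 12 * (\<Sum>i<length X. tree_dist T ((v # X) ! i) (X ! i)).
    executes (reroot [] [] T v) X c"
  using assms
proof (induction X arbitrary: v)
  case Nil
  show ?case by (auto intro: executes.intros)
next
  case (Cons x X)
  then have x: "x \<in> set_tree T" by simp
  have "reach (12 * tree_dist T v x) (reroot [] [] T v, value (reroot [] [] T v))
      (reroot [] [] T x, x)"
    using reroot_reach[OF Cons.prems(1,2) x] value_reroot[OF Cons.prems(1,2)] by simp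
  from search_reach[OF this reach_refl[of 0]] obtain e
    where e: "e \<le> 12 * tree_dist T v x" "search (reroot [] [] T v) x (reroot [] [] T x) e"
    by auto
  obtain c where c: "c \<le> 12 * (\<Sum>i<length X. tree_dist T ((x # X) ! i) (X ! i))"
    "executes (reroot [] [] T x) X c"
    using Cons.IH[of x] Cons.prems x by auto
  have "executes (reroot [] [] T v) (x # X) (e + c)"
    using e(2) c(2) by (rule executes.intros)
  then show ?case using e(1) c(1)
    by (intro exI[of _ "e + c"]) (simp add: sum.lessThan_Suc_shift algebra_simps del: sum.lessThan_Suc)
qed

lemma OPT_le:
  assumes "T \<in> bsts n" "executes T X c"
  shows "OPT n X \<le> c"
  unfolding OPT_def by (rule cInf_lower) (use assms in auto)

lemma OPT_le_min_lazy_cost: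
  assumes "set X \<subseteq> {1..n}"
  shows "OPT n X \<le> 12 * min_lazy_cost n X"
proof -
  obtain T where T: "T \<in> bsts n" "min_lazy_cost n X = lazy_cost T X"
    using min_lazy_cost_attained by blast
  show ?thesis
  proof (cases T)
    case Leaf
    \<comment> \<open>An empty tree means that there are no keys to search for.\<close>
    then have "X = []" using T assms by (auto simp: bsts_def)
    then show ?thesis using OPT_le[OF T(1)] executes.intros(1) by fastforce
  next
    case (Node l a r)
    \<comment> \<open>Hung up at its own root, \<open>T\<close> is unchanged, so the simulation
      starts from a member of \<open>bsts n\<close>.\<close>
    then have "reroot [] [] T (value T) = T" "value T \<in> set_tree T" by auto
    moreover have "bst T" "set X \<subseteq> set_tree T" using T assms by (auto simp: bsts_def)
    ultimately obtain c where "c \<le> 12 * lazy_cost T X" "executes T X c"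
      using executes_reroot[of T "value T" X] by (auto simp: lazy_cost_def)
    with OPT_le[OF T(1)] T(2) show ?thesis by force
  qed
qed

section \<open>Positivity of the optimal cost\<close>

lemma executes_0_value:
  assumes "executes T X c" "c = 0" "x \<in> set X"
  shows "x = value T"
  using assms
proof (induction rule: executes.induct)
  case (2 T y T' c X d)
  then have "search T y T' 0" by simp
  then have "y = value T" "T' = T" by (auto simp: search_def)
  with 2 show ?case by auto
qed simp

text \<open>A run of cost zero never leaves the root or alters the tree, so it finds only one key.
  Positivity keeps the separations from holding trivially against a zero cost.\<close>

lemma OPT_pos:
  assumes "set X \<subseteq> {1..n}" "x \<in> set X" "y \<in> set X" "x \<noteq> y"
  shows "OPT n X > 0"
proof (rule gr0I)
  assume 0: "OPT n X = 0"
  obtain T where T: "executes T X (OPT n X)" using OPT_attained[OF assms(1)] by blast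
  from executes_0_value[OF T 0 assms(2)] executes_0_value[OF T 0 assms(3)] assms(4)
  show False by simp
qed

section \<open>Lower bounds by counting shallow keys\<close>

text \<open>The root and the keys of depth below \<open>e\<close> in either subtree give
  \<open>1 + 2 * (2 ^ e - 1) = 2 ^ Suc e - 1\<close>.\<close>

lemma card_shallow:
  assumes "bst T"
  shows "card {x \<in> set_tree T. depth T x < d} \<le> 2 ^ d - 1"
  using assms
proof (induction T arbitrary: d)
  case (Node l a r)
  show ?case
  proof (cases d)
    case (Suc e)
    let ?S = "\<lambda>t. {x \<in> set_tree t. depth t x < e}"
    have fin: "finite (?S l)" "finite (?S r)" by auto
    have "{x \<in> set_tree \<langle>l, a, r\<rangle>. depth \<langle>l, a, r\<rangle> x < d} \<subseteq> insert a (?S l \<union> ?S r)"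
      using Node.prems Suc by auto
    then have "card {x \<in> set_tree \<langle>l, a, r\<rangle>. depth \<langle>l, a, r\<rangle> x < d} \<le> card (insert a (?S l \<union> ?S r))"
      using fin by (intro card_mono) auto
    also have "\<dots> \<le> Suc (card (?S l) + card (?S r))"
      by (rule card_insert_le_m1) (simp_all add: card_Un_le)
    also have "\<dots> \<le> Suc ((2 ^ e - 1) + (2 ^ e - 1))"
      using Node.IH(1)[of e] Node.IH(2)[of e] Node.prems by simp
    also have "\<dots> = 2 ^ d - 1"
    proof -
      have "(1::nat) \<le> 2 ^ e" by simp
      then show ?thesis unfolding Suc power_Suc by linarith
    qed
    finally show ?thesis .
  qed simp
qed simp

section \<open>The back-and-forth sweep\<close>

definition zigzag :: "nat \<Rightarrow> nat \<Rightarrow> nat" where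
  "zigzag N q = (if q mod (2 * N) < N then Suc (q mod (2 * N)) else 2 * N - q mod (2 * N))"

lemma zigzag_range:
  assumes "N > 0"
  shows "zigzag N q \<in> {1..N}"
proof -
  have "q mod (2 * N) < 2 * N" using assms by simp
  then show ?thesis by (auto simp: zigzag_def)
qed

lemma zigzag_0: "N > 0 \<Longrightarrow> zigzag N 0 = 1"
  by (simp add: zigzag_def)

text \<open>A period has length \<open>2 * N\<close> and runs from 1 up to \<open>N\<close> and back
  down. The turning keys occur twice in succession, whence the case of equality.\<close>

lemma zigzag_Suc:
  assumes "N > 0"
  shows "zigzag N (Suc q) = zigzag N q \<or> zigzag N (Suc q) = Suc (zigzag N q)
    \<or> zigzag N q = Suc (zigzag N (Suc q))"
proof -
  have "q mod (2 * N) < 2 * N" using assms by simp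
  moreover have "Suc q mod (2 * N) = (if Suc (q mod (2 * N)) = 2 * N then 0 else Suc (q mod (2 * N)))"
    by (rule mod_Suc)
  ultimately show ?thesis using assms unfolding zigzag_def by (auto split: if_splits)
qed

text \<open>A position is determined by its period, the key visited there and the direction of the
  sweep. The shift \<open>s\<close> allows for sweeps over keys not starting at 1.\<close>

lemma card_zigzag_visits:
  assumes "N > 0" "finite B"
  shows "card {q. q < M \<and> zigzag N q + s \<in> B} \<le> 2 * (M div (2 * N) + 1) * card B"
proof -
  let ?f = "\<lambda>q. (q div (2 * N), zigzag N q + s, q mod (2 * N) < N)"
  let ?R = "{..M div (2 * N)} \<times> B \<times> (UNIV :: bool set)"
  have "inj_on ?f {q. q < M \<and> zigzag N q + s \<in> B}"
  proof (rule inj_onI)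
    fix p q
    assume *: "?f p = ?f q"
    have "p mod (2 * N) < 2 * N" "q mod (2 * N) < 2 * N" using assms by auto
    then have "p mod (2 * N) = q mod (2 * N)" using * by (auto simp: zigzag_def split: if_splits)
    with * show "p = q" by (metis prod.inject div_mult_mod_eq)
  qed
  moreover have "?f ` {q. q < M \<and> zigzag N q + s \<in> B} \<subseteq> ?R"
    by (auto intro: div_le_mono)
  moreover have "finite ?R" using assms(2) by simp
  ultimately have "card {q. q < M \<and> zigzag N q + s \<in> B} \<le> card ?R"
    by (rule card_inj_on_le)
  also have "card ?R = 2 * (M div (2 * N) + 1) * card B"
    by (simp add: card_cartesian_product)
  finally show ?thesis .
qed

text \<open>The keys of depth below \<open>d\<close> are so few that they account for at most half
  of the visits; each other visit pays at least \<open>d\<close>.\<close>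

lemma sum_depth_zigzag:
  assumes "T \<in> bsts n" "N + s \<le> n" "4 * 2 ^ d \<le> N" "8 * 2 ^ d \<le> M"
  shows "d * M \<le> 2 * (\<Sum>q<M. depth T (zigzag N q + s))"
proof -
  have T: "bst T" "set_tree T = {1..n}" using assms(1) by (auto simp: bsts_def)
  have N: "N > 0" using assms(3) by (metis gr0I le_zero_eq mult_is_0 power_eq_0_iff zero_neq_numeral)
  define B where "B = {x \<in> set_tree T. depth T x < d}"
  define K where "K = M div (2 * N)"
  have B: "finite B" "card B \<le> 2 ^ d"
    using card_shallow[OF T(1), of d] by (auto simp: B_def)
  let ?S = "{q. q < M \<and> zigzag N q + s \<in> B}"
  let ?D = "{..<M} - ?S"
  have "card ?S \<le> 2 * (K + 1) * card B"
    unfolding K_def by (rule card_zigzag_visits[OF N B(1)])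
  also have "\<dots> \<le> 2 * (K + 1) * 2 ^ d" using B(2) by (intro mult_le_mono2)
  finally have S: "card ?S \<le> 2 * (K * 2 ^ d) + 2 * 2 ^ d" by (simp add: algebra_simps)
  \<comment> \<open>The \<open>K\<close> full periods contribute at most a quarter of
    \<open>M\<close> shallow visits, and the unfinished period at most another quarter.\<close>
  have "4 * (K * 2 ^ d) \<le> K * N" using assms(3) mult_le_mono2[OF assms(3), of K] by simp
  moreover have "2 * (K * N) \<le> M"
    using div_times_less_eq_dividend[of M "2 * N"] by (simp add: K_def ac_simps)
  ultimately have "2 * card ?S \<le> M" using S assms(4) by linarith
  moreover have "card ?D = M - card ?S"
    by (subst card_Diff_subset) auto
  ultimately have D: "M \<le> 2 * card ?D" by linarith
  have "d * card ?D = (\<Sum>q\<in>?D. d)" by simp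
  also have "\<dots> \<le> (\<Sum>q\<in>?D. depth T (zigzag N q + s))"
  proof (rule sum_mono)
    fix q assume "q \<in> ?D"
    moreover have "zigzag N q + s \<in> set_tree T"
      using zigzag_range[OF N, of q] assms(2) T(2) by auto
    ultimately show "d \<le> depth T (zigzag N q + s)" by (auto simp: B_def)
  qed
  also have "\<dots> \<le> (\<Sum>q<M. depth T (zigzag N q + s))" by (rule sum_mono2) auto
  finally have "d * card ?D \<le> (\<Sum>q<M. depth T (zigzag N q + s))" .
  moreover have "d * M \<le> 2 * (d * card ?D)" using mult_le_mono2[OF D, of d] by simp
  ultimately show ?thesis by linarith
qed

section \<open>Root finger against lazy finger\<close>

fun right_path :: "nat \<Rightarrow> nat \<Rightarrow> nat tree" where
  "right_path a 0 = \<langle>\<rangle>"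
| "right_path a (Suc k) = \<langle>\<langle>\<rangle>, a, right_path (Suc a) k\<rangle>"

lemma set_right_path: "set_tree (right_path a k) = {a..<a + k}"
  by (induction k arbitrary: a) auto

lemma bst_right_path: "bst (right_path a k)"
  by (induction k arbitrary: a) (auto simp: set_right_path)

lemma tree_dist_right_path:
  assumes "a \<le> i" "Suc i < a + k"
  shows "tree_dist (right_path a k) i (Suc i) \<le> 1"
  using assms
proof (induction k arbitrary: a)
  case (Suc k)
  show ?case
  proof (cases "i = a")
    case True
    obtain k' where "k = Suc k'" using Suc.prems True by (cases k) auto
    then show ?thesis
      using True tree_dist_across[of "\<langle>\<rangle>" a "right_path (Suc a) k" i "Suc i"]
        bst_right_path[of a "Suc k"] by simp
  next
    case False
    then have "tree_dist (right_path a (Suc k)) i (Suc i) = tree_dist (right_path (Suc a) k) i (Suc i)"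
      using Suc.prems tree_dist_right[of "\<langle>\<rangle>" a "right_path (Suc a) k" i "Suc i"]
        bst_right_path[of a "Suc k"] by (simp add: set_right_path)
    then show ?thesis using Suc False by simp
  qed
qed simp

definition zigzag_seq :: "nat \<Rightarrow> nat \<Rightarrow> nat list" where
  "zigzag_seq n m = map (zigzag n) [0..<m]"

lemma length_zigzag_seq [simp]: "length (zigzag_seq n m) = m"
  by (simp add: zigzag_seq_def)

lemma set_zigzag_seq: "n > 0 \<Longrightarrow> set (zigzag_seq n m) \<subseteq> {1..n}"
  using zigzag_range[of n] by (auto simp: zigzag_seq_def)

text \<open>On a path, keys adjacent in order are adjacent in the tree, so each search walks at most
  one edge.\<close>

lemma min_lazy_cost_zigzag_seq:
  assumes "n > 0"
  shows "min_lazy_cost n (zigzag_seq n m) \<le> m"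
proof -
  let ?T = "right_path 1 n"
  have T: "?T \<in> bsts n" by (auto simp: bsts_def set_right_path bst_right_path)
  have inT: "zigzag n q \<in> set_tree ?T" for q
    using zigzag_range[OF assms, of q] by (auto simp: set_right_path)
  have "tree_dist ?T ((value ?T # zigzag_seq n m) ! i) (zigzag_seq n m ! i) \<le> 1" if "i < m" for i
  proof (cases i)
    \<comment> \<open>The path has root 1, where the sweep begins, so the first search is
      free.\<close>
    case 0
    moreover have "value ?T = zigzag n 0" using assms zigzag_0[OF assms] by (cases n) auto
    ultimately show ?thesis
      using that tree_dist_self[OF bst_right_path inT, of 0] by (simp add: zigzag_seq_def)
  next
    case (Suc k)
    have "tree_dist ?T (zigzag n k) (zigzag n (Suc k)) \<le> 1"
      using zigzag_Suc[OF assms, of k]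
    proof (elim disjE)
      assume "zigzag n (Suc k) = zigzag n k"
      then show ?thesis using tree_dist_self[OF bst_right_path inT] by simp
    next
      assume "zigzag n (Suc k) = Suc (zigzag n k)"
      then show ?thesis
        using zigzag_range[OF assms, of "Suc k"] zigzag_range[OF assms, of k]
          tree_dist_right_path[of 1 "zigzag n k" n] by simp
    next
      assume "zigzag n k = Suc (zigzag n (Suc k))"
      then show ?thesis
        using zigzag_range[OF assms, of "Suc k"] zigzag_range[OF assms, of k]
          tree_dist_right_path[of 1 "zigzag n (Suc k)" n]
          tree_dist_commute[OF bst_right_path inT inT, of k "Suc k"] by simp
    qed
    then show ?thesis using that Suc by (simp add: zigzag_seq_def)
  qed
  then have "lazy_cost ?T (zigzag_seq n m) \<le> (\<Sum>i<m. 1)"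
    unfolding lazy_cost_def length_zigzag_seq by (intro sum_mono) auto
  moreover have "min_lazy_cost n (zigzag_seq n m) \<le> lazy_cost ?T (zigzag_seq n m)"
    unfolding min_lazy_cost_def by (rule cINF_lower) (use T in auto)
  ultimately show ?thesis by simp
qed

lemma min_root_cost_zigzag_seq:
  assumes "4 * 2 ^ d \<le> n" "8 * 2 ^ d \<le> m"
  shows "d * m \<le> 2 * min_root_cost n (zigzag_seq n m)"
proof -
  obtain T where T: "T \<in> bsts n"
    "min_root_cost n (zigzag_seq n m) = root_cost T (zigzag_seq n m)"
    using min_root_cost_attained by blast
  have "root_cost T (zigzag_seq n m) = (\<Sum>q<m. depth T (zigzag n q + 0))"
    unfolding root_cost_def by (intro sum.cong) (auto simp: zigzag_seq_def)
  with sum_depth_zigzag[OF T(1), of n 0 d m] assms T(2) show ?thesis by simp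
qed

section \<open>Little omega in two parameters\<close>

lemma eventually_at_top_prod_ge:
  "\<forall>\<^sub>F (n, m) in at_top \<times>\<^sub>F at_top. (N::nat) \<le> n \<and> (M::nat) \<le> m"
  using eventually_prodI[OF eventually_ge_at_top[of N] eventually_ge_at_top[of M]]
  by (simp add: case_prod_unfold)

text \<open>The ratio of the costs exceeds any constant because \<open>d\<close> is at choice. The
  threshold \<open>2 ^ d * 32\<close> leaves room for both families, also when only a third of the
  searches belongs to a sweep.\<close>

lemma smallomega_prodI:
  fixes f g :: "nat \<Rightarrow> nat \<Rightarrow> nat"
  assumes "K > 0"
    and "\<And>d n m. 2 ^ d * 32 \<le> n \<Longrightarrow> 2 ^ d * 32 \<le> m \<Longrightarrow> d * g n m \<le> K * f n m"
  shows "(\<lambda>(n, m). real (f n m)) \<in> \<omega>[at_top \<times>\<^sub>F at_top](\<lambda>(n, m). real (g n m))"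
proof (rule landau_omega.smallI)
  fix c :: real
  assume "c > 0"
  obtain d :: nat where d: "c * real K \<le> real d" using real_arch_simple by blast
  have "c * real (g n m) \<le> real (f n m)" if "2 ^ d * 32 \<le> n" "2 ^ d * 32 \<le> m" for n m
  proof -
    have "c * real K * real (g n m) \<le> real d * real (g n m)"
      using d by (intro mult_right_mono) auto
    also have "\<dots> = real (d * g n m)" by simp
    also have "\<dots> \<le> real (K * f n m)" using assms(2)[OF that] by (simp only: of_nat_le_iff)
    finally have "real K * (c * real (g n m)) \<le> real K * real (f n m)" by (simp add: ac_simps)
    then show ?thesis using assms(1) by simp
  qed
  then show "\<forall>\<^sub>F x in at_top \<times>\<^sub>F at_top.
      c * norm (case x of (n, m) \<Rightarrow> real (g n m)) \<le> norm (case x of (n, m) \<Rightarrow> real (f n m))"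
    by (intro eventually_mono[OF eventually_at_top_prod_ge[of "2 ^ d * 32" "2 ^ d * 32"]]) auto
qed

section \<open>Lazy finger against rotations\<close>

text \<open>With the extreme keys \<open>1\<close> and \<open>n\<close> visited around it, a key \<open>j\<close> costs at least its depth,
  because one of the two walks to \<open>j\<close> passes through the root.\<close>

lemma depth_le_tree_dist_extremes:
  assumes "T \<in> bsts n" "j \<in> {1..n}"
  shows "depth T j \<le> tree_dist T 1 j + tree_dist T j n"
proof (cases T)
  case (Node l a r)
  have T: "bst T" "set_tree T = {1..n}" using assms by (auto simp: bsts_def)
  then have a: "a \<in> {1..n}" using Node by auto
  show ?thesis
  proof (cases "j \<le> a")
    case True
    then have "tree_dist T j n = depth T j + depth T n"
      unfolding Node by (intro tree_dist_across) (use T Node assms a in simp_all)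
    then show ?thesis by simp
  next
    case False
    then have "tree_dist T 1 j = depth T 1 + depth T j"
      unfolding Node by (intro tree_dist_across) (use T Node assms a in simp_all)
    then show ?thesis by simp
  qed
qed simp

text \<open>Blocks \<open>1\<close>, \<open>z + 1\<close>, \<open>n\<close>, with \<open>z\<close>
  sweeping over \<open>{1..n - 2}\<close> and hence \<open>z + 1\<close> over the inner keys. For
  \<open>n < 3\<close> there are no inner keys, and the constant 1 stays in range.\<close>

definition sentinel :: "nat \<Rightarrow> nat \<Rightarrow> nat" where
  "sentinel n i = (if n < 3 \<or> i mod 3 = 0 then 1
     else if i mod 3 = 1 then zigzag (n - 2) (i div 3) + 1 else n)"

definition sentinel_seq :: "nat \<Rightarrow> nat \<Rightarrow> nat list" where
  "sentinel_seq n m = map (sentinel n) [0..<m]"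

lemma length_sentinel_seq [simp]: "length (sentinel_seq n m) = m"
  by (simp add: sentinel_seq_def)

lemma sentinel_range:
  assumes "n > 0"
  shows "sentinel n i \<in> {1..n}"
  using assms zigzag_range[of "n - 2" "i div 3"] by (auto simp: sentinel_def)

lemma set_sentinel_seq: "n > 0 \<Longrightarrow> set (sentinel_seq n m) \<subseteq> {1..n}"
  using sentinel_range[of n] by (auto simp: sentinel_seq_def)

text \<open>In each block this keeps the walks from \<open>1\<close> to the inner key and on to
  \<open>n\<close>, and drops the walk to \<open>1\<close>.\<close>

lemma sum_triple_le:
  fixes f :: "nat \<Rightarrow> nat"
  shows "(\<Sum>q<k. f (3 * q + 1) + f (3 * q + 2)) \<le> (\<Sum>i<3 * k. f i)"
  by (induction k) (auto simp: eval_nat_numeral)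

lemma min_lazy_cost_sentinel_seq:
  assumes "2 ^ d * 32 \<le> n" "2 ^ d * 32 \<le> m"
  shows "d * m \<le> 8 * min_lazy_cost n (sentinel_seq n m)"
proof -
  obtain T where T: "T \<in> bsts n"
    "min_lazy_cost n (sentinel_seq n m) = lazy_cost T (sentinel_seq n m)"
    using min_lazy_cost_attained by blast
  have pow: "(1::nat) \<le> 2 ^ d" by simp
  have n: "n \<ge> 3" using assms(1) pow by linarith
  let ?k = "m div 3"
  let ?f = "\<lambda>i. tree_dist T ((value T # sentinel_seq n m) ! i) (sentinel_seq n m ! i)"
  have k: "m < 3 * ?k + 3" "3 * ?k \<le> m" by auto
  \<comment> \<open>The inner keys form a sweep of \<open>n - 2\<close> keys shifted by 1, with one
    visit per complete block.\<close>
  have "d * ?k \<le> 2 * (\<Sum>q<?k. depth T (zigzag (n - 2) q + 1))"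
    by (rule sum_depth_zigzag[OF T(1)]) (use assms n k pow in linarith)+
  also have "(\<Sum>q<?k. depth T (zigzag (n - 2) q + 1)) \<le> (\<Sum>q<?k. ?f (3 * q + 1) + ?f (3 * q + 2))"
  proof (rule sum_mono)
    fix q
    assume "q \<in> {..<?k}"
    then have q: "3 * q + 2 < m" by auto
    have "zigzag (n - 2) q + 1 \<in> {1..n}" using zigzag_range[of "n - 2" q] n by auto
    moreover have "Suc (3 * q) div 3 = q" by presburger
    ultimately show "depth T (zigzag (n - 2) q + 1) \<le> ?f (3 * q + 1) + ?f (3 * q + 2)"
      using depth_le_tree_dist_extremes[OF T(1), of "zigzag (n - 2) q + 1"] q n
      by (simp add: sentinel_seq_def sentinel_def mod_Suc nth_Cons')
  qed
  also have "(\<Sum>q<?k. ?f (3 * q + 1) + ?f (3 * q + 2)) \<le> (\<Sum>i<3 * ?k. ?f i)"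
    by (rule sum_triple_le)
  also have "\<dots> \<le> lazy_cost T (sentinel_seq n m)"
    unfolding lazy_cost_def by (rule sum_mono2) auto
  finally have "d * ?k \<le> 2 * lazy_cost T (sentinel_seq n m)" by simp
  \<comment> \<open>The at most two searches after the last complete block are absorbed by passing
    from 3 to 4.\<close>
  moreover have "m \<le> 4 * ?k" using k assms(2) pow by linarith
  then have "d * m \<le> d * (4 * ?k)" by (rule mult_le_mono2)
  ultimately show ?thesis unfolding T(2) by linarith
qed

text \<open>The key \<open>j = z + 1\<close> sits at depth 2, with the inner keys below it in two paths
  starting at \<open>j - 1\<close> and \<open>j + 1\<close>, so that a single rotation passes from \<open>j\<close> to a neighbour.\<close>

fun left_path :: "nat \<Rightarrow> nat tree" where
  "left_path 0 = \<langle>\<rangle>"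
| "left_path (Suc k) = \<langle>left_path k, Suc (Suc k), \<langle>\<rangle>\<rangle>"

definition focus_tree :: "nat \<Rightarrow> nat \<Rightarrow> nat tree" where
  "focus_tree n z = \<langle>\<langle>\<langle>\<rangle>, 1, \<langle>left_path (z - 1), z + 1, right_path (z + 2) (n - 2 - z)\<rangle>\<rangle>, n, \<langle>\<rangle>\<rangle>"

lemma reach_rotate_right_grandchild:
  "reach 4 (\<langle>\<langle>\<langle>\<rangle>, a, \<langle>A, b, \<langle>B, c, C\<rangle>\<rangle>\<rangle>, n, \<langle>\<rangle>\<rangle>, n) (\<langle>\<langle>\<langle>\<rangle>, a, \<langle>\<langle>A, b, B\<rangle>, c, C\<rangle>\<rangle>, n, \<langle>\<rangle>\<rangle>, c)"
proof -
  have "reach (Suc (Suc (Suc (Suc 0)))) (\<langle>\<langle>\<langle>\<rangle>, a, \<langle>A, b, \<langle>B, c, C\<rangle>\<rangle>\<rangle>, n, \<langle>\<rangle>\<rangle>, n)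
      (\<langle>\<langle>\<langle>\<rangle>, a, \<langle>\<langle>A, b, B\<rangle>, c, C\<rangle>\<rangle>, n, \<langle>\<rangle>\<rangle>, c)"
    apply (rule reach_step[OF step.move_down[of _ _ a]], simp)
    apply (rule reach_step[OF step.move_down[of _ _ b]], simp)
    apply (rule reach_step[OF step.move_down[of _ _ c]], simp)
    apply (rule reach_step[OF step.rotation reach_refl])
    apply (intro rotate_up.intros)
    done
  then show ?thesis by (simp add: eval_nat_numeral)
qed

lemma reach_rotate_left_grandchild:
  "reach 4 (\<langle>\<langle>\<langle>\<rangle>, a, \<langle>\<langle>A, b, B\<rangle>, c, C\<rangle>\<rangle>, n, \<langle>\<rangle>\<rangle>, n) (\<langle>\<langle>\<langle>\<rangle>, a, \<langle>A, b, \<langle>B, c, C\<rangle>\<rangle>\<rangle>, n, \<langle>\<rangle>\<rangle>, b)"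
proof -
  have "reach (Suc (Suc (Suc (Suc 0)))) (\<langle>\<langle>\<langle>\<rangle>, a, \<langle>\<langle>A, b, B\<rangle>, c, C\<rangle>\<rangle>, n, \<langle>\<rangle>\<rangle>, n)
      (\<langle>\<langle>\<langle>\<rangle>, a, \<langle>A, b, \<langle>B, c, C\<rangle>\<rangle>\<rangle>, n, \<langle>\<rangle>\<rangle>, b)"
    apply (rule reach_step[OF step.move_down[of _ _ a]], simp)
    apply (rule reach_step[OF step.move_down[of _ _ c]], simp)
    apply (rule reach_step[OF step.move_down[of _ _ b]], simp)
    apply (rule reach_step[OF step.rotation reach_refl])
    apply (intro rotate_up.intros)
    done
  then show ?thesis by (simp add: eval_nat_numeral)
qed

text \<open>The two trees differ by one rotation between \<open>z + 1\<close> and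
  \<open>z + 2\<close>: the head of one path becomes the focus, and the old focus becomes the head
  of the other path. Three moves bring the pointer there.\<close>

lemma focus_tree_neighbours:
  assumes "0 < z" "z < n - 2"
  shows "\<exists>v. reach 4 (focus_tree n z, n) (focus_tree n (Suc z), v)"
    and "\<exists>v. reach 4 (focus_tree n (Suc z), n) (focus_tree n z, v)"
proof -
  obtain y where y: "z = Suc y" using assms(1) by (cases z) auto
  define C where "C = right_path (z + 3) (n - 2 - Suc z)"
  have "n - 2 - z = Suc (n - 2 - Suc z)" using assms(2) by simp
  then have z: "focus_tree n z = \<langle>\<langle>\<langle>\<rangle>, 1, \<langle>left_path y, z + 1, \<langle>\<langle>\<rangle>, z + 2, C\<rangle>\<rangle>\<rangle>, n, \<langle>\<rangle>\<rangle>"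
    by (simp add: focus_tree_def C_def y eval_nat_numeral)
  have Sz: "focus_tree n (Suc z) = \<langle>\<langle>\<langle>\<rangle>, 1, \<langle>\<langle>left_path y, z + 1, \<langle>\<rangle>\<rangle>, z + 2, C\<rangle>\<rangle>, n, \<langle>\<rangle>\<rangle>"
    by (simp add: focus_tree_def C_def y eval_nat_numeral)
  show "\<exists>v. reach 4 (focus_tree n z, n) (focus_tree n (Suc z), v)"
    unfolding z Sz by (rule exI) (rule reach_rotate_right_grandchild)
  show "\<exists>v. reach 4 (focus_tree n (Suc z), n) (focus_tree n z, v)"
    unfolding z Sz by (rule exI) (rule reach_rotate_left_grandchild)
qed

text \<open>The keys \<open>1\<close> and \<open>z + 1\<close> are one and two moves away, and the
  tree stays as it is. The key \<open>n\<close> is at the root and found for free, so the steps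
  spent on that search serve to shift the focus for the next block.\<close>

lemma search_focus_tree:
  assumes "n \<ge> 3"
  shows "\<exists>e\<le>4. search (focus_tree n (zigzag (n - 2) (i div 3))) (sentinel n i)
    (focus_tree n (zigzag (n - 2) (Suc i div 3))) e"
proof -
  define z where "z = zigzag (n - 2) (i div 3)"
  define z' where "z' = zigzag (n - 2) (Suc i div 3)"
  let ?T = "focus_tree n z"
  have root: "value ?T = n" by (simp add: focus_tree_def)
  have to_1: "step (?T, n) (?T, 1)"
    by (rule step.move_down) (simp add: focus_tree_def)
  have to_z: "step (?T, 1) (?T, z + 1)"
    by (rule step.move_down) (simp add: focus_tree_def)
  have N: "n - 2 > 0" using assms by simp
  have "\<exists>v. reach 2 (?T, n) (?T, sentinel n i) \<and> z' = z \<or>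
      sentinel n i = n \<and> reach 4 (?T, n) (focus_tree n z', v)"
  proof -
    consider "i mod 3 = 0" | "i mod 3 = 1" | "i mod 3 = 2" by linarith
    then show ?thesis
    proof cases
      case 1
      then have "Suc i div 3 = i div 3" by presburger
      moreover have "sentinel n i = 1" using 1 by (simp add: sentinel_def)
      moreover have "reach (Suc 1) (?T, n) (?T, 1)" by (rule reach_step[OF to_1 reach_refl])
      ultimately show ?thesis by (simp add: z_def z'_def numeral_2_eq_2)
    next
      case 2
      then have "Suc i div 3 = i div 3" by presburger
      moreover have "sentinel n i = z + 1" using 2 assms by (simp add: sentinel_def z_def)
      moreover have "reach (Suc (Suc 0)) (?T, n) (?T, z + 1)"
        by (rule reach_step[OF to_1 reach_step[OF to_z reach_refl]])
      ultimately show ?thesis by (simp add: z_def z'_def numeral_2_eq_2)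
    next
      case 3
      then have "Suc i div 3 = Suc (i div 3)" by presburger
      then have z': "z' = zigzag (n - 2) (Suc (i div 3))" by (simp add: z'_def)
      have bounds: "0 < z" "z \<le> n - 2" "0 < z'" "z' \<le> n - 2"
        using zigzag_range[OF N] by (auto simp: z_def z' Suc_le_eq)
      have "\<exists>v. reach 4 (?T, n) (focus_tree n z', v)"
        using zigzag_Suc[OF N, of "i div 3"] unfolding z'[symmetric] z_def[symmetric]
      proof (elim disjE)
        assume "z' = z"
        then show ?thesis by (intro exI[of _ n]) (simp add: reach_refl)
      next
        assume "z' = Suc z"
        then show ?thesis using focus_tree_neighbours(1)[of z n] bounds by simp
      next
        assume "z = Suc z'"
        then show ?thesis using focus_tree_neighbours(2)[of z' n] bounds by simp
      qed
      moreover have "sentinel n i = n" using 3 assms by (simp add: sentinel_def)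
      ultimately show ?thesis by blast
    qed
  qed
  then consider "reach 2 (?T, value ?T) (?T, sentinel n i)" "z' = z"
    | v where "sentinel n i = value ?T" "reach 4 (?T, value ?T) (focus_tree n z', v)"
    unfolding root by blast
  then have "\<exists>e\<le>4. search ?T (sentinel n i) (focus_tree n z') e"
  proof cases
    case 1
    from search_reach[OF 1(1) reach_refl[of 2]] show ?thesis using 1(2) by simp
  next
    case 2
    from search_reach[OF reach_refl[of 0] 2(2)] show ?thesis using 2(1) by simp
  qed
  then show ?thesis by (simp add: z_def z'_def)
qed

text \<open>Invariant: before position \<open>i\<close> the tree is focused on the inner key of the
  block containing \<open>i\<close>.\<close>

lemma executes_focus_tree:
  assumes "n \<ge> 3"
  shows "\<exists>c\<le>4 * m. executes (focus_tree n (zigzag (n - 2) (i div 3))) (map (sentinel n) [i..<i + m]) c"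
proof (induction m arbitrary: i)
  case 0
  show ?case by (auto intro: executes.intros)
next
  case (Suc m)
  obtain c where c: "c \<le> 4 * m"
    "executes (focus_tree n (zigzag (n - 2) (Suc i div 3))) (map (sentinel n) [Suc i..<Suc i + m]) c"
    using Suc.IH by blast
  obtain e where e: "e \<le> 4" "search (focus_tree n (zigzag (n - 2) (i div 3))) (sentinel n i)
    (focus_tree n (zigzag (n - 2) (Suc i div 3))) e"
    using search_focus_tree[OF assms] by blast
  have "[i..<i + Suc m] = i # [Suc i..<Suc i + m]" by (simp add: upt_conv_Cons del: upt_Suc)
  then show ?case
    using executes.intros(2)[OF e(2) c(2)] e(1) c(1) by (intro exI[of _ "e + c"]) simp
qed

lemma OPT_sentinel_seq:
  assumes "n \<ge> 3"
  shows "OPT n (sentinel_seq n m) \<le> 4 * m"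
proof -
  have "focus_tree n 1 \<in> bsts n"
    using assms by (auto simp: focus_tree_def bsts_def set_right_path bst_right_path)
  moreover have "zigzag (n - 2) (0 div 3) = 1" using assms zigzag_0 by simp
  ultimately show ?thesis
    using executes_focus_tree[OF assms, of m 0] OPT_le unfolding sentinel_seq_def
    by (metis add_0 le_trans)
qed

theorem theorem3:
  shows
    "(\<exists>c>0. \<forall>n X. set X \<subseteq> {1..n} \<longrightarrow>
        real (min_root_cost n X) \<ge> c * real (min_lazy_cost n X)) \<and>
     (\<exists>c>0. \<forall>n X. set X \<subseteq> {1..n} \<longrightarrow>
        real (min_lazy_cost n X) \<ge> c * real (OPT n X)) \<and>
     (\<exists>X1 :: nat \<Rightarrow> nat \<Rightarrow> nat list.
        (\<forall>n\<ge>1. \<forall>m. length (X1 n m) = m \<and> set (X1 n m) \<subseteq> {1..n}) \<and>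
        (\<forall>\<^sub>F (n, m) in at_top \<times>\<^sub>F at_top. min_lazy_cost n (X1 n m) > 0) \<and>
        (\<lambda>(n, m). real (min_root_cost n (X1 n m)))
          \<in> \<omega>[at_top \<times>\<^sub>F at_top](\<lambda>(n, m). real (min_lazy_cost n (X1 n m)))) \<and>
     (\<exists>X2 :: nat \<Rightarrow> nat \<Rightarrow> nat list.
        (\<forall>n\<ge>1. \<forall>m. length (X2 n m) = m \<and> set (X2 n m) \<subseteq> {1..n}) \<and>
        (\<forall>\<^sub>F (n, m) in at_top \<times>\<^sub>F at_top. OPT n (X2 n m) > 0) \<and>
        (\<lambda>(n, m). real (min_lazy_cost n (X2 n m)))
          \<in> \<omega>[at_top \<times>\<^sub>F at_top](\<lambda>(n, m). real (OPT n (X2 n m))))"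
proof (intro conjI)
  have "real (min_root_cost n X) \<ge> 1 / 2 * real (min_lazy_cost n X)" for n X
    using min_lazy_cost_le_min_root_cost[of n X] by linarith
  then show "\<exists>c>0. \<forall>n X. set X \<subseteq> {1..n} \<longrightarrow>
      real (min_root_cost n X) \<ge> c * real (min_lazy_cost n X)"
    by (intro exI[of _ "1 / 2"]) auto
next
  have "real (min_lazy_cost n X) \<ge> 1 / 12 * real (OPT n X)" if "set X \<subseteq> {1..n}" for n X
    using OPT_le_min_lazy_cost[OF that] by linarith
  then show "\<exists>c>0. \<forall>n X. set X \<subseteq> {1..n} \<longrightarrow>
      real (min_lazy_cost n X) \<ge> c * real (OPT n X)"
    by (intro exI[of _ "1 / 12"]) auto
next
  have pos: "min_lazy_cost n (zigzag_seq n m) > 0" if "2 \<le> n" "2 \<le> m" for n m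
  proof -
    have "zigzag n 0 = 1" "zigzag n 1 = 2" using that(1) by (auto simp: zigzag_def)
    moreover have "zigzag n 0 \<in> set (zigzag_seq n m)" "zigzag n 1 \<in> set (zigzag_seq n m)"
      using that(2) by (simp_all add: zigzag_seq_def)
    \<comment> \<open>The lazy cost inherits positivity from \<open>OPT\<close>, which it bounds up
      to a constant.\<close>
    ultimately have "OPT n (zigzag_seq n m) > 0"
      using that set_zigzag_seq by (intro OPT_pos[of _ n "zigzag n 0" "zigzag n 1"]) auto
    then show ?thesis using OPT_le_min_lazy_cost[of "zigzag_seq n m" n] set_zigzag_seq[of n m] that
      by linarith
  qed
  have bound: "d * min_lazy_cost n (zigzag_seq n m) \<le> 2 * min_root_cost n (zigzag_seq n m)"
    if "2 ^ d * 32 \<le> n" "2 ^ d * 32 \<le> m" for d n m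
  proof -
    have pow: "(1::nat) \<le> 2 ^ d" by simp
    then have "n > 0" using that(1) by linarith
    then have "d * min_lazy_cost n (zigzag_seq n m) \<le> d * m"
      using min_lazy_cost_zigzag_seq by (intro mult_le_mono2)
    also have "\<dots> \<le> 2 * min_root_cost n (zigzag_seq n m)"
      by (rule min_root_cost_zigzag_seq) (use that in linarith)+
    finally show ?thesis .
  qed
  show "\<exists>X1 :: nat \<Rightarrow> nat \<Rightarrow> nat list.
        (\<forall>n\<ge>1. \<forall>m. length (X1 n m) = m \<and> set (X1 n m) \<subseteq> {1..n}) \<and>
        (\<forall>\<^sub>F (n, m) in at_top \<times>\<^sub>F at_top. min_lazy_cost n (X1 n m) > 0) \<and>
        (\<lambda>(n, m). real (min_root_cost n (X1 n m)))
          \<in> \<omega>[at_top \<times>\<^sub>F at_top](\<lambda>(n, m). real (min_lazy_cost n (X1 n m)))"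
  proof (intro exI[of _ zigzag_seq] conjI allI impI)
    show "\<forall>\<^sub>F (n, m) in at_top \<times>\<^sub>F at_top. min_lazy_cost n (zigzag_seq n m) > 0"
      by (rule eventually_mono[OF eventually_at_top_prod_ge[of 2 2]]) (use pos in auto)
    show "(\<lambda>(n, m). real (min_root_cost n (zigzag_seq n m)))
        \<in> \<omega>[at_top \<times>\<^sub>F at_top](\<lambda>(n, m). real (min_lazy_cost n (zigzag_seq n m)))"
      by (rule smallomega_prodI[of 2]) (use bound in auto)
  qed (use set_zigzag_seq in auto)
next
  have pos: "OPT n (sentinel_seq n m) > 0" if "3 \<le> n" "3 \<le> m" for n m
  proof -
    have "sentinel n 0 = 1" "sentinel n 2 = n" using that(1) by (auto simp: sentinel_def)
    moreover have "sentinel n 0 \<in> set (sentinel_seq n m)" "sentinel n 2 \<in> set (sentinel_seq n m)"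
      using that(2) by (simp_all add: sentinel_seq_def)
    ultimately show ?thesis
      using that set_sentinel_seq by (intro OPT_pos[of _ n "sentinel n 0" "sentinel n 2"]) auto
  qed
  \<comment> \<open>The factor 32 combines \<open>OPT\<close> being at most \<open>4 * m\<close>
    with \<open>d * m\<close> being at most 8 times the lazy cost.\<close>
  have bound: "d * OPT n (sentinel_seq n m) \<le> 32 * min_lazy_cost n (sentinel_seq n m)"
    if "2 ^ d * 32 \<le> n" "2 ^ d * 32 \<le> m" for d n m
  proof -
    have pow: "(1::nat) \<le> 2 ^ d" by simp
    then have "n \<ge> 3" using that(1) by linarith
    then have "d * OPT n (sentinel_seq n m) \<le> d * (4 * m)"
      using OPT_sentinel_seq by (intro mult_le_mono2)
    then show ?thesis using min_lazy_cost_sentinel_seq[OF that] by linarith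
  qed
  show "\<exists>X2 :: nat \<Rightarrow> nat \<Rightarrow> nat list.
        (\<forall>n\<ge>1. \<forall>m. length (X2 n m) = m \<and> set (X2 n m) \<subseteq> {1..n}) \<and>
        (\<forall>\<^sub>F (n, m) in at_top \<times>\<^sub>F at_top. OPT n (X2 n m) > 0) \<and>
        (\<lambda>(n, m). real (min_lazy_cost n (X2 n m)))
          \<in> \<omega>[at_top \<times>\<^sub>F at_top](\<lambda>(n, m). real (OPT n (X2 n m)))"
  proof (intro exI[of _ sentinel_seq] conjI allI impI)
    show "\<forall>\<^sub>F (n, m) in at_top \<times>\<^sub>F at_top. OPT n (sentinel_seq n m) > 0"
      by (rule eventually_mono[OF eventually_at_top_prod_ge[of 3 3]]) (use pos in auto)
    show "(\<lambda>(n, m). real (min_lazy_cost n (sentinel_seq n m)))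
        \<in> \<omega>[at_top \<times>\<^sub>F at_top](\<lambda>(n, m). real (OPT n (sentinel_seq n m)))"
      by (rule smallomega_prodI[of 32]) (use bound in auto)
  qed (use set_sentinel_seq in auto)
qed

end
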